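(* Let $\mathscr A$ be a profinitary exact category. Then $\mathscr A$ is cofinitary if and only if its Grothendieck monoid $\Gamma_{\mathscr A}$ is locally finite, i.e. for every $\gamma\in\Gamma_{\mathscr A}$ the set $\{(\alpha,\beta)\in\Gamma_{\mathscr A}\times\Gamma_{\mathscr A}:\alpha+\beta=\gamma\}$ is finite.
   Context: All categories are essentially small; exact categories are in the sense of Quillen. $\mathrm{Iso}\,\mathscr A$ is the set of isomorphism classes $[X]$ of objects, an abelian monoid under $[X]+[Y]=[X\oplus Y]$. $\underline{\mathrm{Ext}}^1_{\mathscr A}(A,B)$ is the set of all $[X]$ such that there is a short exact sequence $B\rightarrowtail X\twoheadrightarrow A$. The Grothendieck monoid $\Gamma_{\mathscr A}$ is the quotient of $\mathrm{Iso}\,\mathscr A$ by the congruence which is the transitive closure of: $[X]\equiv[Y]$ if $[X],[Y]\in\underline{\mathrm{Ext}}^1_{\mathscr A}(M,N)$ for some $M,N$; $|X|$ is the image of $X$ in $\Gamma_{\mathscr A}$ and $\mathrm{Iso}\,\mathscr A_\gamma=\{[X]:|X|=\gamma\}$. A Hom-finite exact category (all Hom sets finite) is profinitary if $\mathrm{Iso}\,\mathscr A_\gamma$ is finite for all $\gamma\in\Gamma_{\mathscr A}$, and cofinitary if for every $[X]$ the set of pairs $([A],[B])\in\mathrm{Iso}\,\mathscr A\times\mathrm{Iso}\,\mathscr A$ with $[X]\in\underline{\mathrm{Ext}}^1_{\mathscr A}(A,B)$ is finite. *)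

theory Defs
  imports "HOL-Algebra.Group"
begin

section \<open>Additive categories\<close>

record ('o, 'm) additive_cat =
  Obj :: "'o set"
  Arr :: "'m set"
  Dom :: "'m \<Rightarrow> 'o"
  Cod :: "'m \<Rightarrow> 'o"
  Ident :: "'o \<Rightarrow> 'm"
  Comp :: "'m \<Rightarrow> 'm \<Rightarrow> 'm" (infixl "\<cdot>\<index>" 70)
  Plus :: "'m \<Rightarrow> 'm \<Rightarrow> 'm" (infixl "\<boxplus>\<index>" 65)
  Zero :: "'o \<Rightarrow> 'o \<Rightarrow> 'm"

text \<open>
  Composition is in the applicative order: \<open>g \<cdot> f\<close> is ``first \<open>f\<close>, then \<open>g\<close>''.
  Values of the operations outside the intended domain (arrows with matching ends) are unconstrained.
\<close>

definition Hom :: "('o, 'm, 'z) additive_cat_scheme \<Rightarrow> 'o \<Rightarrow> 'o \<Rightarrow> 'm set" where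
  "Hom C A B = {f \<in> Arr C. Dom C f = A \<and> Cod C f = B}"

definition hom_group :: "('o, 'm, 'z) additive_cat_scheme \<Rightarrow> 'o \<Rightarrow> 'o \<Rightarrow> 'm monoid" where
  "hom_group C A B = \<lparr>carrier = Hom C A B, mult = Plus C, one = Zero C A B\<rparr>"

definition is_iso_arrow :: "('o, 'm, 'z) additive_cat_scheme \<Rightarrow> 'm \<Rightarrow> bool" where
  "is_iso_arrow C f \<longleftrightarrow> f \<in> Arr C \<and>
     (\<exists>g \<in> Hom C (Cod C f) (Dom C f).
        g \<cdot>\<^bsub>C\<^esub> f = Ident C (Dom C f) \<and> f \<cdot>\<^bsub>C\<^esub> g = Ident C (Cod C f))"

definition isomorphic :: "('o, 'm, 'z) additive_cat_scheme \<Rightarrow> 'o \<Rightarrow> 'o \<Rightarrow> bool" where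
  "isomorphic C A B \<longleftrightarrow> (\<exists>f \<in> Hom C A B. is_iso_arrow C f)"

definition is_zero_object :: "('o, 'm, 'z) additive_cat_scheme \<Rightarrow> 'o \<Rightarrow> bool" where
  "is_zero_object C Z \<longleftrightarrow> Z \<in> Obj C \<and>
     (\<forall>A \<in> Obj C. (\<exists>!f. f \<in> Hom C Z A) \<and> (\<exists>!f. f \<in> Hom C A Z))"

definition is_biproduct ::
  "('o, 'm, 'z) additive_cat_scheme \<Rightarrow> 'o \<Rightarrow> 'o \<Rightarrow> 'o \<Rightarrow> 'm \<Rightarrow> 'm \<Rightarrow> 'm \<Rightarrow> 'm \<Rightarrow> bool" where
  "is_biproduct C A B S i1 i2 p1 p2 \<longleftrightarrow>
     A \<in> Obj C \<and> B \<in> Obj C \<and> S \<in> Obj C \<and>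
     i1 \<in> Hom C A S \<and> i2 \<in> Hom C B S \<and> p1 \<in> Hom C S A \<and> p2 \<in> Hom C S B \<and>
     p1 \<cdot>\<^bsub>C\<^esub> i1 = Ident C A \<and> p2 \<cdot>\<^bsub>C\<^esub> i2 = Ident C B \<and>
     p1 \<cdot>\<^bsub>C\<^esub> i2 = Zero C B A \<and> p2 \<cdot>\<^bsub>C\<^esub> i1 = Zero C A B \<and>
     (i1 \<cdot>\<^bsub>C\<^esub> p1) \<boxplus>\<^bsub>C\<^esub> (i2 \<cdot>\<^bsub>C\<^esub> p2) = Ident C S"

locale category =
  fixes C :: "('o, 'm, 'z) additive_cat_scheme" (structure)
  assumes dom_obj: "f \<in> Arr C \<Longrightarrow> Dom C f \<in> Obj C"
    and cod_obj: "f \<in> Arr C \<Longrightarrow> Cod C f \<in> Obj C"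
    and ident_hom: "A \<in> Obj C \<Longrightarrow> Ident C A \<in> Hom C A A"
    and comp_hom: "\<lbrakk>f \<in> Hom C A B; g \<in> Hom C B D\<rbrakk> \<Longrightarrow> g \<cdot> f \<in> Hom C A D"
    and comp_ident_right: "f \<in> Hom C A B \<Longrightarrow> f \<cdot> Ident C A = f"
    and comp_ident_left: "f \<in> Hom C A B \<Longrightarrow> Ident C B \<cdot> f = f"
    and comp_assoc: "\<lbrakk>f \<in> Hom C A B; g \<in> Hom C B D; h \<in> Hom C D F\<rbrakk>
      \<Longrightarrow> (h \<cdot> g) \<cdot> f = h \<cdot> (g \<cdot> f)"

locale preadditive_category = category +
  assumes hom_comm_group: "\<lbrakk>A \<in> Obj C; B \<in> Obj C\<rbrakk> \<Longrightarrow> comm_group (hom_group C A B)"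
    and comp_plus_right: "\<lbrakk>f \<in> Hom C A B; f' \<in> Hom C A B; g \<in> Hom C B D\<rbrakk>
      \<Longrightarrow> g \<cdot> (f \<boxplus> f') = (g \<cdot> f) \<boxplus> (g \<cdot> f')"
    and comp_plus_left: "\<lbrakk>f \<in> Hom C A B; g \<in> Hom C B D; g' \<in> Hom C B D\<rbrakk>
      \<Longrightarrow> (g \<boxplus> g') \<cdot> f = (g \<cdot> f) \<boxplus> (g' \<cdot> f)"

locale additive_category = preadditive_category +
  assumes ex_zero_object: "\<exists>Z. is_zero_object C Z"
    and ex_biproduct: "\<lbrakk>A \<in> Obj C; B \<in> Obj C\<rbrakk>
      \<Longrightarrow> \<exists>S i1 i2 p1 p2. is_biproduct C A B S i1 i2 p1 p2"


section \<open>Kernels, cokernels, pullbacks and pushouts\<close>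

definition is_kernel :: "('o, 'm, 'z) additive_cat_scheme \<Rightarrow> 'm \<Rightarrow> 'm \<Rightarrow> bool" where
  "is_kernel C i p \<longleftrightarrow>
     i \<in> Arr C \<and> p \<in> Arr C \<and> Cod C i = Dom C p \<and>
     p \<cdot>\<^bsub>C\<^esub> i = Zero C (Dom C i) (Cod C p) \<and>
     (\<forall>f \<in> Arr C. Cod C f = Dom C p \<and> p \<cdot>\<^bsub>C\<^esub> f = Zero C (Dom C f) (Cod C p) \<longrightarrow>
        (\<exists>!u. u \<in> Hom C (Dom C f) (Dom C i) \<and> i \<cdot>\<^bsub>C\<^esub> u = f))"

definition is_cokernel :: "('o, 'm, 'z) additive_cat_scheme \<Rightarrow> 'm \<Rightarrow> 'm \<Rightarrow> bool" where
  "is_cokernel C p i \<longleftrightarrow>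
     i \<in> Arr C \<and> p \<in> Arr C \<and> Cod C i = Dom C p \<and>
     p \<cdot>\<^bsub>C\<^esub> i = Zero C (Dom C i) (Cod C p) \<and>
     (\<forall>f \<in> Arr C. Dom C f = Cod C i \<and> f \<cdot>\<^bsub>C\<^esub> i = Zero C (Dom C i) (Cod C f) \<longrightarrow>
        (\<exists>!u. u \<in> Hom C (Cod C p) (Cod C f) \<and> u \<cdot>\<^bsub>C\<^esub> p = f))"

text \<open>\<open>is_pullback C p f p' f'\<close>: the square \<open>p \<cdot> f' = f \<cdot> p'\<close> is Cartesian; \<open>p'\<close> is the base change
  of \<open>p\<close> along \<open>f\<close>.\<close>

definition is_pullback ::
  "('o, 'm, 'z) additive_cat_scheme \<Rightarrow> 'm \<Rightarrow> 'm \<Rightarrow> 'm \<Rightarrow> 'm \<Rightarrow> bool" where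
  "is_pullback C p f p' f' \<longleftrightarrow>
     p \<in> Arr C \<and> f \<in> Arr C \<and> p' \<in> Arr C \<and> f' \<in> Arr C \<and>
     Cod C p = Cod C f \<and> Dom C p' = Dom C f' \<and> Cod C p' = Dom C f \<and> Cod C f' = Dom C p \<and>
     p \<cdot>\<^bsub>C\<^esub> f' = f \<cdot>\<^bsub>C\<^esub> p' \<and>
     (\<forall>T \<in> Obj C. \<forall>a \<in> Hom C T (Dom C p). \<forall>b \<in> Hom C T (Dom C f).
        p \<cdot>\<^bsub>C\<^esub> a = f \<cdot>\<^bsub>C\<^esub> b \<longrightarrow>
        (\<exists>!u. u \<in> Hom C T (Dom C p') \<and> f' \<cdot>\<^bsub>C\<^esub> u = a \<and> p' \<cdot>\<^bsub>C\<^esub> u = b))"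

text \<open>\<open>is_pushout C i f i' f'\<close>: the square \<open>f' \<cdot> i = i' \<cdot> f\<close> is co-Cartesian; \<open>i'\<close> is the cobase
  change of \<open>i\<close> along \<open>f\<close>.\<close>

definition is_pushout ::
  "('o, 'm, 'z) additive_cat_scheme \<Rightarrow> 'm \<Rightarrow> 'm \<Rightarrow> 'm \<Rightarrow> 'm \<Rightarrow> bool" where
  "is_pushout C i f i' f' \<longleftrightarrow>
     i \<in> Arr C \<and> f \<in> Arr C \<and> i' \<in> Arr C \<and> f' \<in> Arr C \<and>
     Dom C i = Dom C f \<and> Cod C i' = Cod C f' \<and> Dom C i' = Cod C f \<and> Dom C f' = Cod C i \<and>
     f' \<cdot>\<^bsub>C\<^esub> i = i' \<cdot>\<^bsub>C\<^esub> f \<and>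
     (\<forall>T \<in> Obj C. \<forall>a \<in> Hom C (Cod C i) T. \<forall>b \<in> Hom C (Cod C f) T.
        a \<cdot>\<^bsub>C\<^esub> i = b \<cdot>\<^bsub>C\<^esub> f \<longrightarrow>
        (\<exists>!u. u \<in> Hom C (Cod C i') T \<and> u \<cdot>\<^bsub>C\<^esub> f' = a \<and> u \<cdot>\<^bsub>C\<^esub> i' = b))"


section \<open>Exact categories\<close>

text \<open>\<open>(i, p) \<in> Confl C\<close> means that \<open>Dom i \<rightarrow> Cod i = Dom p \<rightarrow> Cod p\<close> is one of the
  distinguished short exact sequences.\<close>

record ('o, 'm) exact_cat = "('o, 'm) additive_cat" +
  Confl :: "('m \<times> 'm) set"

definition admissible_mono :: "('o, 'm, 'z) exact_cat_scheme \<Rightarrow> 'm \<Rightarrow> bool" where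
  "admissible_mono C i \<longleftrightarrow> (\<exists>p. (i, p) \<in> Confl C)"

definition admissible_epi :: "('o, 'm, 'z) exact_cat_scheme \<Rightarrow> 'm \<Rightarrow> bool" where
  "admissible_epi C p \<longleftrightarrow> (\<exists>i. (i, p) \<in> Confl C)"

text \<open>
  The axioms are those of Quillen, \<^emph>\<open>Higher algebraic K-theory I\<close>, Section 2.  The last two
  (the ``obscure axiom'' and its dual) are known to follow from the others (Keller); they are kept
  because they are part of Quillen's definition.
\<close>

locale exact_category = additive_category C
  for C :: "('o, 'm, 'z) exact_cat_scheme" (structure) +
  assumes confl_iso_closed:
    "\<lbrakk>(i, p) \<in> Confl C; i' \<in> Arr C; p' \<in> Arr C; Cod C i' = Dom C p';
      a \<in> Hom C (Dom C i) (Dom C i'); is_iso_arrow C a;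
      b \<in> Hom C (Cod C i) (Cod C i'); is_iso_arrow C b;
      c \<in> Hom C (Cod C p) (Cod C p'); is_iso_arrow C c;
      i' \<cdot> a = b \<cdot> i; p' \<cdot> b = c \<cdot> p\<rbrakk> \<Longrightarrow> (i', p') \<in> Confl C"
    and confl_split: "is_biproduct C A B S i1 i2 p1 p2 \<Longrightarrow> (i1, p2) \<in> Confl C"
    and confl_kernel: "(i, p) \<in> Confl C \<Longrightarrow> is_kernel C i p"
    and confl_cokernel: "(i, p) \<in> Confl C \<Longrightarrow> is_cokernel C p i"
    and admissible_epi_comp:
      "\<lbrakk>admissible_epi C p; admissible_epi C q; Cod C p = Dom C q\<rbrakk> \<Longrightarrow> admissible_epi C (q \<cdot> p)"
    and admissible_mono_comp:
      "\<lbrakk>admissible_mono C i; admissible_mono C j; Cod C i = Dom C j\<rbrakk> \<Longrightarrow> admissible_mono C (j \<cdot> i)"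
    and admissible_epi_base_change:
      "\<lbrakk>admissible_epi C p; f \<in> Arr C; Cod C f = Cod C p\<rbrakk>
        \<Longrightarrow> \<exists>p' f'. is_pullback C p f p' f' \<and> admissible_epi C p'"
    and admissible_mono_cobase_change:
      "\<lbrakk>admissible_mono C i; f \<in> Arr C; Dom C f = Dom C i\<rbrakk>
        \<Longrightarrow> \<exists>i' f'. is_pushout C i f i' f' \<and> admissible_mono C i'"
    and admissible_epi_obscure:
      "\<lbrakk>is_kernel C k p; g \<in> Arr C; Cod C g = Dom C p; admissible_epi C (p \<cdot> g)\<rbrakk>
        \<Longrightarrow> admissible_epi C p"
    and admissible_mono_obscure:
      "\<lbrakk>is_cokernel C q i; g \<in> Arr C; Dom C g = Cod C i; admissible_mono C (g \<cdot> i)\<rbrakk>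
        \<Longrightarrow> admissible_mono C i"


section \<open>Isomorphism classes and the Grothendieck monoid\<close>

definition iso_class :: "('o, 'm, 'z) additive_cat_scheme \<Rightarrow> 'o \<Rightarrow> 'o set" where
  "iso_class C X = {Y \<in> Obj C. isomorphic C X Y}"

text \<open>
  Abelian monoids are written multiplicatively, as in \<open>HOL-Algebra\<close>: \<open>\<otimes>\<close> is the addition of
  isomorphism classes and of elements of the Grothendieck monoid.  Since a direct sum is determined
  only up to isomorphism, \<open>[X] + [Y]\<close> is given as the set of all direct sums of
  objects of \<open>[X]\<close> and \<open>[Y]\<close>; this is the class of any of them.
\<close>

definition Iso :: "('o, 'm, 'z) additive_cat_scheme \<Rightarrow> 'o set monoid" where
  "Iso C =
     \<lparr>carrier = {iso_class C X | X. X \<in> Obj C},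
      mult = (\<lambda>U V. {S. \<exists>X \<in> U. \<exists>Y \<in> V. \<exists>i1 i2 p1 p2. is_biproduct C X Y S i1 i2 p1 p2}),
      one = {Z. is_zero_object C Z}\<rparr>"

definition Ext1 :: "('o, 'm, 'z) exact_cat_scheme \<Rightarrow> 'o \<Rightarrow> 'o \<Rightarrow> 'o set set" where
  "Ext1 C A B = {iso_class C X | X. X \<in> Obj C \<and>
     (\<exists>(i, p) \<in> Confl C. i \<in> Hom C B X \<and> p \<in> Hom C X A)}"

definition groth_cong :: "('o, 'm, 'z) exact_cat_scheme \<Rightarrow> ('o set \<times> 'o set) set" where
  "groth_cong C =
     {(U, V). \<exists>M \<in> Obj C. \<exists>N \<in> Obj C. U \<in> Ext1 C M N \<and> V \<in> Ext1 C M N}\<^sup>+"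

definition groth_monoid :: "('o, 'm, 'z) exact_cat_scheme \<Rightarrow> 'o set set monoid" where
  "groth_monoid C =
     \<lparr>carrier = carrier (Iso C) // groth_cong C,
      mult = (\<lambda>\<alpha> \<beta>. \<Union>U \<in> \<alpha>. \<Union>V \<in> \<beta>. groth_cong C `` {U \<otimes>\<^bsub>Iso C\<^esub> V}),
      one = groth_cong C `` {\<one>\<^bsub>Iso C\<^esub>}\<rparr>"

definition groth_class :: "('o, 'm, 'z) exact_cat_scheme \<Rightarrow> 'o \<Rightarrow> 'o set set" where
  "groth_class C X = groth_cong C `` {iso_class C X}"

definition Iso_fiber :: "('o, 'm, 'z) exact_cat_scheme \<Rightarrow> 'o set set \<Rightarrow> 'o set set" where
  "Iso_fiber C \<gamma> = {iso_class C X | X. X \<in> Obj C \<and> groth_class C X = \<gamma>}"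


section \<open>Finiteness conditions\<close>

locale hom_finite_exact_category = exact_category +
  assumes finite_hom: "\<lbrakk>A \<in> Obj C; B \<in> Obj C\<rbrakk> \<Longrightarrow> finite (Hom C A B)"

locale profinitary = hom_finite_exact_category +
  assumes finite_fiber: "\<gamma> \<in> carrier (groth_monoid C) \<Longrightarrow> finite (Iso_fiber C \<gamma>)"

locale cofinitary = hom_finite_exact_category +
  assumes finite_pairs: "U \<in> carrier (Iso C) \<Longrightarrow>
    finite {(iso_class C A, iso_class C B) | A B. A \<in> Obj C \<and> B \<in> Obj C \<and> U \<in> Ext1 C A B}"

definition locally_finite :: "('a, 'b) monoid_scheme \<Rightarrow> bool" where
  "locally_finite G \<longleftrightarrow> (\<forall>\<gamma> \<in> carrier G.
     finite {(\<alpha>, \<beta>). \<alpha> \<in> carrier G \<and> \<beta> \<in> carrier G \<and> \<alpha> \<otimes>\<^bsub>G\<^esub> \<beta> = \<gamma>})"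

end

theory Submission
  imports Defs
begin

text \<open>
  A direct sum is an extension, so \<open>\<bar>A\<bar> + \<bar>B\<bar> = \<bar>X\<bar>\<close> for every short exact sequence
  \<open>B \<rightarrow> X \<rightarrow> A\<close>.  If \<open>\<Gamma>\<close> is locally finite, then \<open>\<bar>X\<bar>\<close> leaves finitely many choices for
  \<open>(\<bar>A\<bar>, \<bar>B\<bar>)\<close>, and finiteness of the fibers leaves finitely many for \<open>([A], [B])\<close>.  Conversely,
  \<open>\<alpha> + \<beta> = \<gamma>\<close> means that \<open>\<alpha> = \<bar>A\<bar>\<close> and \<open>\<beta> = \<bar>B\<bar>\<close> with \<open>[A \<oplus> B]\<close> in the finite fiber over \<open>\<gamma>\<close>,
  and each element of this fiber is an extension of finitely many pairs \<open>([A], [B])\<close>.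

  That the addition of \<open>\<Gamma>\<close> does not depend on representatives rests on the fact that a
  short exact sequence \<open>N \<rightarrow> X \<rightarrow> M\<close> yields a short exact sequence
  \<open>N \<rightarrow> X \<oplus> Y \<rightarrow> M \<oplus> Y\<close>: the first arrow is a composite of admissible monomorphisms, and
  the second one is its cokernel.
\<close>

section \<open>Isomorphisms and biproducts\<close>

context category
begin

lemma hom_obj:
  assumes "f \<in> Hom C A B"
  shows "A \<in> Obj C" and "B \<in> Obj C"
  using assms dom_obj cod_obj by (auto simp: Hom_def)

lemma isomorphicI:
  assumes "f \<in> Hom C A B" "g \<in> Hom C B A" "g \<cdot> f = Ident C A" "f \<cdot> g = Ident C B"
  shows "isomorphic C A B"
  using assms unfolding isomorphic_def is_iso_arrow_def Hom_def by auto

lemma isomorphicE: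
  assumes "isomorphic C A B"
  obtains f g where "f \<in> Hom C A B" "g \<in> Hom C B A" "g \<cdot> f = Ident C A" "f \<cdot> g = Ident C B"
  using assms unfolding isomorphic_def is_iso_arrow_def Hom_def by auto

lemma is_iso_arrowI:
  assumes "f \<in> Hom C A B" "g \<in> Hom C B A" "g \<cdot> f = Ident C A" "f \<cdot> g = Ident C B"
  shows "is_iso_arrow C f"
  using assms unfolding is_iso_arrow_def Hom_def by auto

lemma is_iso_arrow_ident:
  assumes "A \<in> Obj C"
  shows "is_iso_arrow C (Ident C A)"
  using assms ident_hom comp_ident_left by (blast intro: is_iso_arrowI)

lemma isomorphic_refl: "A \<in> Obj C \<Longrightarrow> isomorphic C A A"
  using ident_hom comp_ident_left by (blast intro: isomorphicI)

lemma isomorphic_sym: "isomorphic C A B \<Longrightarrow> isomorphic C B A"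
  by (metis isomorphicE isomorphicI)

lemma arrow_from_zero_object_unique:
  assumes "is_zero_object C Z" "f \<in> Hom C Z A" "g \<in> Hom C Z A"
  shows "f = g"
  using assms hom_obj unfolding is_zero_object_def by blast

end

section \<open>Zero arrows and direct sums in a preadditive category\<close>

context preadditive_category
begin

text \<open>The group laws of \<open>hom_group\<close>, read off for the raw operations
  \<open>Plus\<close> and \<open>Zero\<close>. The last one, that an idempotent of a group is
  neutral, is what forces composites with a zero arrow to vanish.\<close>

lemma
  assumes "A \<in> Obj C" "B \<in> Obj C"
  shows zero_hom: "Zero C A B \<in> Hom C A B"
    and plus_hom: "f \<in> Hom C A B \<Longrightarrow> g \<in> Hom C A B \<Longrightarrow> f \<boxplus> g \<in> Hom C A B"
    and plus_comm: "f \<in> Hom C A B \<Longrightarrow> g \<in> Hom C A B \<Longrightarrow> f \<boxplus> g = g \<boxplus> f"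
    and plus_zero_left: "f \<in> Hom C A B \<Longrightarrow> Zero C A B \<boxplus> f = f"
    and plus_zero_right: "f \<in> Hom C A B \<Longrightarrow> f \<boxplus> Zero C A B = f"
    and plus_idem_zero: "f \<in> Hom C A B \<Longrightarrow> f \<boxplus> f = f \<Longrightarrow> f = Zero C A B"
proof -
  interpret comm_group "hom_group C A B"
    using assms by (rule hom_comm_group)
  show "Zero C A B \<in> Hom C A B"
    using one_closed by (simp add: hom_group_def)
  show "f \<in> Hom C A B \<Longrightarrow> g \<in> Hom C A B \<Longrightarrow> f \<boxplus> g \<in> Hom C A B"
    using m_closed by (simp add: hom_group_def)
  show "f \<in> Hom C A B \<Longrightarrow> g \<in> Hom C A B \<Longrightarrow> f \<boxplus> g = g \<boxplus> f"
    using m_comm by (simp add: hom_group_def)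
  show "f \<in> Hom C A B \<Longrightarrow> Zero C A B \<boxplus> f = f"
    using l_one by (simp add: hom_group_def)
  show "f \<in> Hom C A B \<Longrightarrow> f \<boxplus> Zero C A B = f"
    using r_one by (simp add: hom_group_def)
  show "f \<in> Hom C A B \<Longrightarrow> f \<boxplus> f = f \<Longrightarrow> f = Zero C A B"
    using l_cancel_one[of f f] by (simp add: hom_group_def)
qed

text \<open>Distributivity applied to \<open>0 + 0 = 0\<close> makes the composite idempotent for
  addition, hence zero.\<close>

lemma comp_zero_right:
  assumes "A \<in> Obj C" "g \<in> Hom C B D"
  shows "g \<cdot> Zero C A B = Zero C A D"
proof -
  have z: "Zero C A B \<in> Hom C A B"
    using assms hom_obj zero_hom by blast
  have "(g \<cdot> Zero C A B) \<boxplus> (g \<cdot> Zero C A B) = g \<cdot> Zero C A B"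
    using comp_plus_right[OF z z assms(2)] plus_zero_left[OF assms(1) _ z] hom_obj[OF z] by simp
  then show ?thesis
    using plus_idem_zero comp_hom[OF z assms(2)] hom_obj by blast
qed

lemma comp_zero_left:
  assumes "D \<in> Obj C" "f \<in> Hom C A B"
  shows "Zero C B D \<cdot> f = Zero C A D"
proof -
  have z: "Zero C B D \<in> Hom C B D"
    using assms hom_obj zero_hom by blast
  have "(Zero C B D \<cdot> f) \<boxplus> (Zero C B D \<cdot> f) = Zero C B D \<cdot> f"
    using comp_plus_left[OF assms(2) z z] plus_zero_left[OF _ assms(1) z] hom_obj[OF z] by simp
  then show ?thesis
    using plus_idem_zero comp_hom[OF assms(2) z] hom_obj by blast
qed

lemma is_biproduct_swap:
  assumes "is_biproduct C A B S i1 i2 p1 p2"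
  shows "is_biproduct C B A S i2 i1 p2 p1"
proof -
  have "S \<in> Obj C" "i1 \<cdot> p1 \<in> Hom C S S" "i2 \<cdot> p2 \<in> Hom C S S"
    using assms comp_hom unfolding is_biproduct_def by blast+
  then have "(i2 \<cdot> p2) \<boxplus> (i1 \<cdot> p1) = (i1 \<cdot> p1) \<boxplus> (i2 \<cdot> p2)"
    using plus_comm by blast
  with assms show ?thesis
    unfolding is_biproduct_def by simp
qed

text \<open>Compose \<open>u\<close> with the identity of \<open>S\<close> written as the sum of
  \<open>i1 \<cdot> p1\<close> and \<open>i2 \<cdot> p2\<close>.\<close>

lemma copair_decomp:
  assumes S: "is_biproduct C A B S i1 i2 p1 p2" and u: "u \<in> Hom C S W"
  shows "u = ((u \<cdot> i1) \<cdot> p1) \<boxplus> ((u \<cdot> i2) \<cdot> p2)"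
proof -
  have h: "i1 \<in> Hom C A S" "i2 \<in> Hom C B S" "p1 \<in> Hom C S A" "p2 \<in> Hom C S B"
    using S unfolding is_biproduct_def by auto
  have "u = u \<cdot> ((i1 \<cdot> p1) \<boxplus> (i2 \<cdot> p2))"
    using S u comp_ident_right unfolding is_biproduct_def by simp
  also have "\<dots> = (u \<cdot> (i1 \<cdot> p1)) \<boxplus> (u \<cdot> (i2 \<cdot> p2))"
    using comp_plus_right[OF comp_hom[OF h(3,1)] comp_hom[OF h(4,2)] u] .
  also have "\<dots> = ((u \<cdot> i1) \<cdot> p1) \<boxplus> ((u \<cdot> i2) \<cdot> p2)"
    using comp_assoc[OF h(3,1) u] comp_assoc[OF h(4,2) u] by simp
  finally show ?thesis .
qed

lemma copair_eqI:
  assumes "is_biproduct C A B S i1 i2 p1 p2" "u \<in> Hom C S W" "v \<in> Hom C S W"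
    and "u \<cdot> i1 = v \<cdot> i1" "u \<cdot> i2 = v \<cdot> i2"
  shows "u = v"
  using copair_decomp[OF assms(1,2)] copair_decomp[OF assms(1,3)] assms(4,5) by simp

text \<open>Existence half of the coproduct property, with the sum of \<open>a \<cdot> p1\<close>
  and \<open>b \<cdot> p2\<close> as witness; \<open>copair_eqI\<close> is the uniqueness
  half.\<close>

lemma copairE:
  assumes S: "is_biproduct C A B S i1 i2 p1 p2" and a: "a \<in> Hom C A W" and b: "b \<in> Hom C B W"
  obtains u where "u \<in> Hom C S W" "u \<cdot> i1 = a" "u \<cdot> i2 = b"
proof
  have h: "i1 \<in> Hom C A S" "i2 \<in> Hom C B S" "p1 \<in> Hom C S A" "p2 \<in> Hom C S B"
    and e: "p1 \<cdot> i1 = Ident C A" "p2 \<cdot> i2 = Ident C B"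
      "p1 \<cdot> i2 = Zero C B A" "p2 \<cdot> i1 = Zero C A B"
    using S unfolding is_biproduct_def by auto
  have ap: "a \<cdot> p1 \<in> Hom C S W" and bp: "b \<cdot> p2 \<in> Hom C S W"
    using a b h comp_hom by blast+
  have o: "A \<in> Obj C" "B \<in> Obj C" "W \<in> Obj C"
    using a b hom_obj by blast+
  show "(a \<cdot> p1) \<boxplus> (b \<cdot> p2) \<in> Hom C S W"
    using plus_hom ap bp hom_obj by blast
  show "((a \<cdot> p1) \<boxplus> (b \<cdot> p2)) \<cdot> i1 = a"
    using comp_plus_left[OF h(1) ap bp] comp_assoc[OF h(1,3) a] comp_assoc[OF h(1,4) b] e
      comp_ident_right[OF a] comp_zero_right[OF o(1) b] plus_zero_right[OF o(1,3) a] by simp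
  show "((a \<cdot> p1) \<boxplus> (b \<cdot> p2)) \<cdot> i2 = b"
    using comp_plus_left[OF h(2) ap bp] comp_assoc[OF h(2,3) a] comp_assoc[OF h(2,4) b] e
      comp_ident_right[OF b] comp_zero_right[OF o(2) a] plus_zero_left[OF o(2,3) b] by simp
qed

lemma biproduct_unique:
  assumes S: "is_biproduct C A B S i1 i2 p1 p2" and T: "is_biproduct C A B T j1 j2 q1 q2"
  shows "isomorphic C S T"
proof -
  have h: "i1 \<in> Hom C A S" "i2 \<in> Hom C B S" "j1 \<in> Hom C A T" "j2 \<in> Hom C B T"
    and o: "S \<in> Obj C" "T \<in> Obj C"
    using S T unfolding is_biproduct_def by auto
  obtain u where u: "u \<in> Hom C S T" "u \<cdot> i1 = j1" "u \<cdot> i2 = j2"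
    using copairE[OF S h(3,4)] .
  obtain v where v: "v \<in> Hom C T S" "v \<cdot> j1 = i1" "v \<cdot> j2 = i2"
    using copairE[OF T h(1,2)] .
  have "v \<cdot> u = Ident C S"
    using u v h comp_assoc[OF h(1) u(1) v(1)] comp_assoc[OF h(2) u(1) v(1)] comp_ident_left
    by (intro copair_eqI[OF S comp_hom[OF u(1) v(1)] ident_hom[OF o(1)]]) simp_all
  moreover have "u \<cdot> v = Ident C T"
    using u v h comp_assoc[OF h(3) v(1) u(1)] comp_assoc[OF h(4) v(1) u(1)] comp_ident_left
    by (intro copair_eqI[OF T comp_hom[OF v(1) u(1)] ident_hom[OF o(2)]]) simp_all
  ultimately show ?thesis
    using u v isomorphicI by blast
qed

text \<open>Injections are composed with an isomorphism from \<open>S\<close> to \<open>T\<close>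
  and projections with its inverse. This makes every object of the class of a direct sum a direct
  sum of the same two objects.\<close>

lemma biproduct_transport_sum:
  assumes S: "is_biproduct C A B S i1 i2 p1 p2" and "isomorphic C S T"
  shows "\<exists>j1 j2 q1 q2. is_biproduct C A B T j1 j2 q1 q2"
proof -
  obtain f g where f: "f \<in> Hom C S T" and g: "g \<in> Hom C T S"
    and gf: "g \<cdot> f = Ident C S" and fg: "f \<cdot> g = Ident C T"
    using assms(2) by (rule isomorphicE)
  have h: "i1 \<in> Hom C A S" "i2 \<in> Hom C B S" "p1 \<in> Hom C S A" "p2 \<in> Hom C S B"
    and o: "A \<in> Obj C" "B \<in> Obj C" "T \<in> Obj C"
    and e: "p1 \<cdot> i1 = Ident C A" "p2 \<cdot> i2 = Ident C B"
      "p1 \<cdot> i2 = Zero C B A" "p2 \<cdot> i1 = Zero C A B"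
      "(i1 \<cdot> p1) \<boxplus> (i2 \<cdot> p2) = Ident C S"
    using S f hom_obj unfolding is_biproduct_def by auto
  have cancel: "(q \<cdot> g) \<cdot> (f \<cdot> i) = q \<cdot> i" if "q \<in> Hom C S D" "i \<in> Hom C E S" for q i D E
    using comp_assoc[OF comp_hom[OF that(2) f] g that(1)] comp_assoc[OF that(2) f g]
      comp_ident_left[OF that(2)] gf by simp
  have shuffle: "(f \<cdot> i) \<cdot> (p \<cdot> g) = f \<cdot> ((i \<cdot> p) \<cdot> g)" if "i \<in> Hom C D S" "p \<in> Hom C S D" for i p D
    using comp_assoc[OF comp_hom[OF g that(2)] that(1) f] comp_assoc[OF g that(2,1)] by simp
  have ip: "i1 \<cdot> p1 \<in> Hom C S S" "i2 \<cdot> p2 \<in> Hom C S S"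
    using h comp_hom by blast+
  have "((f \<cdot> i1) \<cdot> (p1 \<cdot> g)) \<boxplus> ((f \<cdot> i2) \<cdot> (p2 \<cdot> g)) = f \<cdot> (((i1 \<cdot> p1) \<boxplus> (i2 \<cdot> p2)) \<cdot> g)"
    using comp_plus_left[OF g ip] comp_plus_right[OF comp_hom[OF g ip(1)] comp_hom[OF g ip(2)] f]
      shuffle h by simp
  also have "\<dots> = Ident C T"
    using e(5) comp_ident_left[OF g] fg by simp
  finally have "is_biproduct C A B T (f \<cdot> i1) (f \<cdot> i2) (p1 \<cdot> g) (p2 \<cdot> g)"
    using h o e comp_hom[OF _ f] comp_hom[OF g] cancel unfolding is_biproduct_def by simp
  then show ?thesis
    by blast
qed

text \<open>The isomorphism is absorbed into the first injection and projection. The second summand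
  is handled by the same lemma after \<open>is_biproduct_swap\<close>.\<close>

lemma biproduct_transport_left:
  assumes S: "is_biproduct C A B S i1 i2 p1 p2" and "isomorphic C A A'"
  shows "\<exists>j1 j2 q1 q2. is_biproduct C A' B S j1 j2 q1 q2"
proof -
  obtain f g where f: "f \<in> Hom C A A'" and g: "g \<in> Hom C A' A"
    and gf: "g \<cdot> f = Ident C A" and fg: "f \<cdot> g = Ident C A'"
    using assms(2) by (rule isomorphicE)
  have h: "i1 \<in> Hom C A S" "i2 \<in> Hom C B S" "p1 \<in> Hom C S A" "p2 \<in> Hom C S B"
    and o: "A' \<in> Obj C" "B \<in> Obj C" "S \<in> Obj C"
    and e: "p1 \<cdot> i1 = Ident C A" "p2 \<cdot> i2 = Ident C B"
      "p1 \<cdot> i2 = Zero C B A" "p2 \<cdot> i1 = Zero C A B"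
      "(i1 \<cdot> p1) \<boxplus> (i2 \<cdot> p2) = Ident C S"
    using S f hom_obj unfolding is_biproduct_def by auto
  have "(f \<cdot> p1) \<cdot> (i1 \<cdot> g) = Ident C A'"
    using comp_assoc[OF comp_hom[OF g h(1)] h(3) f] comp_assoc[OF g h(1,3)] e(1)
      comp_ident_left[OF g] fg by simp
  moreover have "(i1 \<cdot> g) \<cdot> (f \<cdot> p1) = i1 \<cdot> p1"
    using comp_assoc[OF comp_hom[OF h(3) f] g h(1)] comp_assoc[OF h(3) f g] gf
      comp_ident_left[OF h(3)] by simp
  moreover have "(f \<cdot> p1) \<cdot> i2 = Zero C B A'"
    using comp_assoc[OF h(2,3) f] e(3) comp_zero_right[OF o(2) f] by simp
  moreover have "p2 \<cdot> (i1 \<cdot> g) = Zero C A' B"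
    using comp_assoc[OF g h(1,4)] e(4) comp_zero_left[OF o(2) g] by simp
  ultimately have "is_biproduct C A' B S (i1 \<cdot> g) i2 (f \<cdot> p1) p2"
    using h o e comp_hom[OF g h(1)] comp_hom[OF h(3) f] unfolding is_biproduct_def by simp
  then show ?thesis
    by blast
qed

text \<open>The product in \<open>Iso C\<close> is a set of direct sums over all representatives.
  Uniqueness of biproducts puts them all into one class, and transport along isomorphisms fills that
  class.\<close>

lemma Iso_mult_biproduct:
  assumes S: "is_biproduct C X Y S i1 i2 p1 p2"
  shows "iso_class C X \<otimes>\<^bsub>Iso C\<^esub> iso_class C Y = iso_class C S"
proof -
  have o: "X \<in> Obj C" "Y \<in> Obj C" "S \<in> Obj C"
    using S unfolding is_biproduct_def by auto
  have "isomorphic C S T"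
    if XX': "isomorphic C X X'" and YY': "isomorphic C Y Y'"
      and T: "is_biproduct C X' Y' T j1 j2 q1 q2"
    for X' Y' T j1 j2 q1 q2
  proof -
    \<comment> \<open>Replace \<open>X'\<close> by \<open>X\<close>, swap, then replace
      \<open>Y'\<close> by \<open>Y\<close>; the summands end up in reverse order and are swapped
      back for the comparison with \<open>S\<close>.\<close>
    obtain j1 j2 q1 q2 where "is_biproduct C X Y' T j1 j2 q1 q2"
      using biproduct_transport_left[OF T isomorphic_sym[OF XX']] by blast
    then obtain j1 j2 q1 q2 where "is_biproduct C Y X T j1 j2 q1 q2"
      using biproduct_transport_left[OF is_biproduct_swap isomorphic_sym[OF YY']] by blast
    then show ?thesis
      using biproduct_unique[OF S] is_biproduct_swap by blast
  qed
  moreover have "T \<in> Obj C" if "is_biproduct C X' Y' T j1 j2 q1 q2" for X' Y' T j1 j2 q1 q2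
    using that unfolding is_biproduct_def by blast
  ultimately have "{T. \<exists>X' \<in> iso_class C X. \<exists>Y' \<in> iso_class C Y. \<exists>j1 j2 q1 q2.
      is_biproduct C X' Y' T j1 j2 q1 q2} = iso_class C S" (is "?L = _")
  proof (intro equalityI subsetI)
    fix T assume "T \<in> iso_class C S"
    then obtain j1 j2 q1 q2 where "is_biproduct C X Y T j1 j2 q1 q2"
      using biproduct_transport_sum[OF S] unfolding iso_class_def by blast
    moreover have "X \<in> iso_class C X" "Y \<in> iso_class C Y"
      using o isomorphic_refl unfolding iso_class_def by auto
    ultimately show "T \<in> ?L"
      by blast
  qed (auto simp: iso_class_def)
  then show ?thesis
    unfolding Iso_def by simp
qed

lemma is_biproduct_zero_object:
  assumes Z: "is_zero_object C Z" and X: "X \<in> Obj C"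
  shows "is_biproduct C Z X X (Zero C Z X) (Ident C X) (Zero C X Z) (Ident C X)"
proof -
  have o: "Z \<in> Obj C"
    using Z unfolding is_zero_object_def by blast
  \<comment> \<open>Both sides are endomorphisms of a zero object.\<close>
  have "Zero C X Z \<cdot> Zero C Z X = Ident C Z"
    using arrow_from_zero_object_unique[OF Z] comp_hom zero_hom ident_hom o X by meson
  then show ?thesis
    unfolding is_biproduct_def
    using o X zero_hom[OF o X] zero_hom[OF X o] ident_hom[OF X] comp_ident_left[OF ident_hom[OF X]]
      comp_ident_left[OF zero_hom[OF o X]] comp_ident_right[OF zero_hom[OF X o]]
      comp_zero_left[OF X zero_hom[OF X o]] plus_zero_left[OF X X ident_hom[OF X]]
    by simp
qed

text \<open>The comparison arrows from the two universal properties are mutually inverse, since each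
  round trip and the identity factor the same cokernel through itself. The equation
  \<open>c \<cdot> p = q\<close> is what later lets a conflation be moved from one cokernel to
  another.\<close>

lemma cokernel_unique:
  assumes p: "is_cokernel C p i" and q: "is_cokernel C q i"
  obtains c where "c \<in> Hom C (Cod C p) (Cod C q)" "is_iso_arrow C c" "c \<cdot> p = q"
proof -
  have hp: "p \<in> Hom C (Cod C i) (Cod C p)" and hq: "q \<in> Hom C (Cod C i) (Cod C q)"
    using p q unfolding is_cokernel_def Hom_def by auto
  obtain c where c: "c \<in> Hom C (Cod C p) (Cod C q)" "c \<cdot> p = q"
    using p q unfolding is_cokernel_def by metis
  obtain d where d: "d \<in> Hom C (Cod C q) (Cod C p)" "d \<cdot> q = p"
    using p q unfolding is_cokernel_def by metis
  have "d \<cdot> c = Ident C (Cod C p)"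
  proof -
    have "\<exists>!u. u \<in> Hom C (Cod C p) (Cod C p) \<and> u \<cdot> p = p"
      using p unfolding is_cokernel_def by metis
    moreover have "(d \<cdot> c) \<cdot> p = p"
      using comp_assoc[OF hp c(1) d(1)] c d by simp
    ultimately show ?thesis
      using comp_hom[OF c(1) d(1)] ident_hom hom_obj(2)[OF hp] comp_ident_left[OF hp] by metis
  qed
  moreover have "c \<cdot> d = Ident C (Cod C q)"
  proof -
    have "\<exists>!u. u \<in> Hom C (Cod C q) (Cod C q) \<and> u \<cdot> q = q"
      using q unfolding is_cokernel_def by metis
    moreover have "(c \<cdot> d) \<cdot> q = q"
      using comp_assoc[OF hq d(1) c(1)] c d by simp
    ultimately show ?thesis
      using comp_hom[OF d(1) c(1)] ident_hom hom_obj(2)[OF hq] comp_ident_left[OF hq] by metis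
  qed
  ultimately show ?thesis
    using that c d is_iso_arrowI by blast
qed

end

section \<open>The Grothendieck monoid\<close>

context exact_category
begin

text \<open>Adding \<open>Y\<close> to the middle and right terms leaves the left term
  \<open>N\<close> fixed. The composite \<open>i1 \<cdot> i\<close> is an admissible monomorphism,
  so it starts some conflation; its second arrow is then replaced by the explicit cokernel
  \<open>q\<close>, whose target is the prescribed \<open>T\<close>.\<close>

lemma confl_sum:
  assumes ip: "(i, p) \<in> Confl C" and i: "i \<in> Hom C N X" and p: "p \<in> Hom C X M"
    and S: "is_biproduct C X Y S i1 i2 p1 p2" and T: "is_biproduct C M Y T j1 j2 q1 q2"
  shows "\<exists>q. (i1 \<cdot> i, q) \<in> Confl C \<and> q \<in> Hom C S T"
proof -
  have h: "i1 \<in> Hom C X S" "i2 \<in> Hom C Y S" "j1 \<in> Hom C M T" "j2 \<in> Hom C Y T"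
    using S T unfolding is_biproduct_def by auto
  have coker: "is_cokernel C p i"
    using confl_cokernel[OF ip] .
  have pi: "p \<cdot> i = Zero C N M"
    using coker i p unfolding is_cokernel_def Hom_def by auto
  \<comment> \<open>The universal property of \<open>p\<close>, rephrased with hom sets in place of
    \<open>Dom\<close> and \<open>Cod\<close>.\<close>
  have p_factor: "\<exists>!u. u \<in> Hom C M W \<and> u \<cdot> p = f" if "f \<in> Hom C X W" "f \<cdot> i = Zero C N W" for f W
  proof -
    have "f \<in> Arr C" "Dom C f = X" "Cod C f = W" "Dom C i = N" "Cod C i = X" "Cod C p = M"
      using i p that(1) unfolding Hom_def by auto
    with that(2) show ?thesis
      using coker[unfolded is_cokernel_def, THEN conjunct2, THEN conjunct2, THEN conjunct2,
        THEN conjunct2, THEN bspec[of _ _ f]] by simp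
  qed
  have i1i: "i1 \<cdot> i \<in> Hom C N S"
    using comp_hom[OF i h(1)] .
  \<comment> \<open>This \<open>q\<close> is the direct sum of \<open>p\<close> and the identity of
    \<open>Y\<close>.\<close>
  obtain q where q: "q \<in> Hom C S T" "q \<cdot> i1 = j1 \<cdot> p" "q \<cdot> i2 = j2"
    using copairE[OF S comp_hom[OF p h(3)] h(4)] .
  have "q \<cdot> (i1 \<cdot> i) = Zero C N T"
    using comp_assoc[OF i h(1) q(1)] q(2) comp_assoc[OF i p h(3)] pi
      comp_zero_right[OF hom_obj(1)[OF i] h(3)] by simp
  moreover have "\<exists>!v. v \<in> Hom C T W \<and> v \<cdot> q = f"
    if f: "f \<in> Hom C S W" and f0: "f \<cdot> (i1 \<cdot> i) = Zero C N W" for f W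
  proof -
    have fi1: "f \<cdot> i1 \<in> Hom C X W" and fi2: "f \<cdot> i2 \<in> Hom C Y W"
      using f h comp_hom by blast+
    have fi1i: "(f \<cdot> i1) \<cdot> i = Zero C N W"
      using comp_assoc[OF i h(1) f] f0 by simp
    note factor = p_factor[OF fi1 fi1i]
    obtain u where u: "u \<in> Hom C M W" "u \<cdot> p = f \<cdot> i1"
      using factor by blast
    \<comment> \<open>On the summand \<open>M\<close> the factorization comes from the cokernel
      \<open>p\<close>; on \<open>Y\<close> it is \<open>f\<close> itself.\<close>
    obtain v where v: "v \<in> Hom C T W" "v \<cdot> j1 = u" "v \<cdot> j2 = f \<cdot> i2"
      using copairE[OF T u(1) fi2] .
    have "v \<cdot> q = f"
      using comp_assoc[OF h(1) q(1) v(1)] comp_assoc[OF h(2) q(1) v(1)] q u v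
        comp_assoc[OF p h(3) v(1)]
      by (intro copair_eqI[OF S comp_hom[OF q(1) v(1)] f]) simp_all
    moreover have "w = v" if w: "w \<in> Hom C T W" "w \<cdot> q = f" for w
    proof (rule copair_eqI[OF T w(1) v(1)])
      have "(w \<cdot> j1) \<cdot> p = f \<cdot> i1"
        using comp_assoc[OF p h(3) w(1)] comp_assoc[OF h(1) q(1) w(1)] q w by simp
      then show "w \<cdot> j1 = v \<cdot> j1"
        using factor u v(2) comp_hom[OF h(3) w(1)] by metis
      show "w \<cdot> j2 = v \<cdot> j2"
        using comp_assoc[OF h(2) q(1) w(1)] q w v by simp
    qed
    ultimately show ?thesis
      using v(1) by blast
  qed
  ultimately have coker_q: "is_cokernel C q (i1 \<cdot> i)"
    using i1i q(1) unfolding is_cokernel_def Hom_def by auto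
  have "admissible_mono C i" "admissible_mono C i1"
    using ip confl_split[OF S] unfolding admissible_mono_def by blast+
  then have "admissible_mono C (i1 \<cdot> i)"
    using admissible_mono_comp i h(1) unfolding Hom_def by auto
  \<comment> \<open>Admissibility supplies only some second arrow \<open>r\<close>. It is a cokernel
    of the same arrow as \<open>q\<close>, so the two differ by an isomorphism of targets, and
    closure of \<open>Confl C\<close> under isomorphism yields \<open>q\<close>.\<close>
  then obtain r where r: "(i1 \<cdot> i, r) \<in> Confl C"
    unfolding admissible_mono_def by blast
  have coker_r: "is_cokernel C r (i1 \<cdot> i)"
    using confl_cokernel[OF r] .
  obtain c where c: "c \<in> Hom C (Cod C r) (Cod C q)" "is_iso_arrow C c" "c \<cdot> r = q"
    using cokernel_unique[OF coker_r coker_q] .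
  have ends: "Dom C (i1 \<cdot> i) = N" "Cod C (i1 \<cdot> i) = S" "i1 \<cdot> i \<in> Arr C" "q \<in> Arr C" "Dom C q = S"
    using i1i q(1) unfolding Hom_def by auto
  have o: "N \<in> Obj C" "S \<in> Obj C"
    using i1i hom_obj by blast+
  have "(i1 \<cdot> i, q) \<in> Confl C"
    by (rule confl_iso_closed[OF r, where a = "Ident C N" and b = "Ident C S" and c = c])
      (use ends o c ident_hom is_iso_arrow_ident comp_ident_left[OF i1i] comp_ident_right[OF i1i]
        comp_ident_right[OF q(1)] in simp_all)
  then show ?thesis
    using q(1) by blast
qed

section \<open>Extensions and the congruence they generate\<close>

lemma Ext1_subset_Iso: "Ext1 C M N \<subseteq> carrier (Iso C)"
  unfolding Ext1_def Iso_def by auto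

text \<open>In \<open>Ext1 C A B\<close> the subobject is \<open>B\<close>, whereas
  \<open>confl_split\<close> has the first summand as subobject; hence the swap.\<close>

lemma biproduct_in_Ext1:
  assumes "is_biproduct C A B S i1 i2 p1 p2"
  shows "iso_class C S \<in> Ext1 C A B"
proof -
  have "(i2, p1) \<in> Confl C"
    using confl_split[OF is_biproduct_swap[OF assms]] .
  with assms show ?thesis
    unfolding Ext1_def is_biproduct_def by blast
qed

text \<open>The end terms \<open>T\<close> and \<open>N\<close> do not depend on \<open>U\<close>.
  Two classes in the same \<open>Ext1 C M N\<close> therefore remain in a common extension set after
  \<open>Y\<close> is added, which is the compatibility of the generating relation with
  addition.\<close>

lemma Ext1_sum:
  assumes "U \<in> Ext1 C M N" and Y: "Y \<in> Obj C" and T: "is_biproduct C M Y T j1 j2 q1 q2"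
  shows "U \<otimes>\<^bsub>Iso C\<^esub> iso_class C Y \<in> Ext1 C T N"
proof -
  obtain X i p where X: "U = iso_class C X" "X \<in> Obj C" and ip: "(i, p) \<in> Confl C"
    and i: "i \<in> Hom C N X" and p: "p \<in> Hom C X M"
    using assms(1) unfolding Ext1_def by blast
  obtain S i1 i2 p1 p2 where S: "is_biproduct C X Y S i1 i2 p1 p2"
    using ex_biproduct[OF X(2) Y] by blast
  obtain q where q: "(i1 \<cdot> i, q) \<in> Confl C" "q \<in> Hom C S T"
    using confl_sum[OF ip i p S T] by blast
  have "i1 \<in> Hom C X S"
    using S unfolding is_biproduct_def by blast
  then have "i1 \<cdot> i \<in> Hom C N S"
    using comp_hom i by blast
  then have "iso_class C S \<in> Ext1 C T N"
    using q hom_obj unfolding Ext1_def by blast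
  then show ?thesis
    using X(1) Iso_mult_biproduct[OF S] by simp
qed

lemma groth_congI:
  assumes "M \<in> Obj C" "N \<in> Obj C" "U \<in> Ext1 C M N" "V \<in> Ext1 C M N"
  shows "(U, V) \<in> groth_cong C"
  using assms unfolding groth_cong_def by blast

lemma equiv_groth_cong: "equiv (carrier (Iso C)) (groth_cong C)"
proof (rule equivI)
  show "groth_cong C \<subseteq> carrier (Iso C) \<times> carrier (Iso C)"
    unfolding groth_cong_def by (rule trancl_subset_Sigma) (use Ext1_subset_Iso in blast)
  show "refl_on (carrier (Iso C)) (groth_cong C)"
  proof (rule refl_onI)
    fix U assume "U \<in> carrier (Iso C)"
    then obtain X where X: "U = iso_class C X" "X \<in> Obj C"
      unfolding Iso_def by auto
    obtain Z where Z: "is_zero_object C Z"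
      using ex_zero_object by blast
    then have "Z \<in> Obj C"
      unfolding is_zero_object_def by blast
    \<comment> \<open>A transitive closure is not reflexive by itself: here \<open>X\<close>, as the
      direct sum of \<open>Z\<close> and \<open>X\<close>, is an extension of \<open>Z\<close> by
      \<open>X\<close>, so its class is related to itself.\<close>
    then show "(U, U) \<in> groth_cong C"
      using groth_congI biproduct_in_Ext1[OF is_biproduct_zero_object[OF Z X(2)]] X by blast
  qed
  show "sym (groth_cong C)"
    unfolding groth_cong_def by (rule sym_trancl) (auto simp: sym_def)
  show "trans (groth_cong C)"
    unfolding groth_cong_def by (rule trans_trancl)
qed

lemma Iso_mult_comm:
  assumes "U \<in> carrier (Iso C)" "V \<in> carrier (Iso C)"
  shows "U \<otimes>\<^bsub>Iso C\<^esub> V = V \<otimes>\<^bsub>Iso C\<^esub> U"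
  using is_biproduct_swap unfolding Iso_def by (simp, blast)

text \<open>Induction along a chain of generating pairs; each link is translated by \<open>W\<close>
  through \<open>Ext1_sum\<close>.\<close>

lemma groth_cong_mult_right:
  assumes "(U, V) \<in> groth_cong C" and W: "W \<in> carrier (Iso C)"
  shows "(U \<otimes>\<^bsub>Iso C\<^esub> W, V \<otimes>\<^bsub>Iso C\<^esub> W) \<in> groth_cong C"
proof -
  obtain Y where Y: "W = iso_class C Y" "Y \<in> Obj C"
    using W unfolding Iso_def by auto
  have base_step: "(U \<otimes>\<^bsub>Iso C\<^esub> W, V \<otimes>\<^bsub>Iso C\<^esub> W) \<in> groth_cong C"
    if M: "M \<in> Obj C" and N: "N \<in> Obj C" and UV: "U \<in> Ext1 C M N" "V \<in> Ext1 C M N" for U V M N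
  proof -
    obtain T j1 j2 q1 q2 where T: "is_biproduct C M Y T j1 j2 q1 q2"
      using ex_biproduct[OF M Y(2)] by blast
    then have "T \<in> Obj C"
      unfolding is_biproduct_def by blast
    then show ?thesis
      using groth_congI[OF _ N] Ext1_sum[OF _ Y(2) T] UV Y(1) by blast
  qed
  show ?thesis
    using assms(1) unfolding groth_cong_def
  proof (induction rule: trancl_induct)
    case (base V)
    then show ?case
      using base_step unfolding groth_cong_def by blast
  next
    case (step V V')
    then have "(V \<otimes>\<^bsub>Iso C\<^esub> W, V' \<otimes>\<^bsub>Iso C\<^esub> W) \<in> groth_cong C"
      using base_step by blast
    with step.IH show ?case
      unfolding groth_cong_def by (rule trancl_trans)
  qed
qed

lemma groth_cong_mult:
  assumes "(U, U') \<in> groth_cong C" "(V, V') \<in> groth_cong C"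
  shows "(U \<otimes>\<^bsub>Iso C\<^esub> V, U' \<otimes>\<^bsub>Iso C\<^esub> V') \<in> groth_cong C"
proof -
  have c: "U \<in> carrier (Iso C)" "U' \<in> carrier (Iso C)" "V \<in> carrier (Iso C)" "V' \<in> carrier (Iso C)"
    using assms equiv_groth_cong unfolding equiv_def by blast+
  have "(U \<otimes>\<^bsub>Iso C\<^esub> V, U' \<otimes>\<^bsub>Iso C\<^esub> V) \<in> groth_cong C"
    using groth_cong_mult_right[OF assms(1) c(3)] .
  \<comment> \<open>The second factor is changed by translating on the right and using commutativity
    on both sides.\<close>
  moreover have "(U' \<otimes>\<^bsub>Iso C\<^esub> V, U' \<otimes>\<^bsub>Iso C\<^esub> V') \<in> groth_cong C"
    using groth_cong_mult_right[OF assms(2) c(2)] Iso_mult_comm c by simp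
  ultimately show ?thesis
    using equiv_groth_cong by (meson equivE transE)
qed

section \<open>Sums of classes in the Grothendieck monoid\<close>

lemma groth_class_carrier: "X \<in> Obj C \<Longrightarrow> groth_class C X \<in> carrier (groth_monoid C)"
  unfolding groth_class_def groth_monoid_def Iso_def by (auto intro: quotientI)

lemma groth_monoid_cases:
  assumes "\<alpha> \<in> carrier (groth_monoid C)"
  obtains X where "X \<in> Obj C" "\<alpha> = groth_class C X"
  using assms unfolding groth_class_def groth_monoid_def Iso_def by (auto elim!: quotientE)

text \<open>The product is a union over all representatives. By \<open>groth_cong_mult\<close> all
  its members are the same class, and the union is nonempty because each class contains its own
  representative.\<close>

lemma groth_mult_biproduct:
  assumes S: "is_biproduct C A B S i1 i2 p1 p2"
  shows "groth_class C A \<otimes>\<^bsub>groth_monoid C\<^esub> groth_class C B = groth_class C S"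
proof -
  let ?U = "iso_class C A" and ?V = "iso_class C B"
  have "A \<in> Obj C" "B \<in> Obj C"
    using S unfolding is_biproduct_def by auto
  then have "?U \<in> carrier (Iso C)" "?V \<in> carrier (Iso C)"
    unfolding Iso_def by auto
  then have "?U \<in> groth_class C A" "?V \<in> groth_class C B"
    using equiv_class_self[OF equiv_groth_cong] unfolding groth_class_def by auto
  moreover have "groth_cong C `` {U \<otimes>\<^bsub>Iso C\<^esub> V} = groth_class C S"
    if "U \<in> groth_class C A" "V \<in> groth_class C B" for U V
  proof -
    have "(?U \<otimes>\<^bsub>Iso C\<^esub> ?V, U \<otimes>\<^bsub>Iso C\<^esub> V) \<in> groth_cong C"
      using that groth_cong_mult unfolding groth_class_def by blast
    then show ?thesis
      using equiv_class_eq[OF equiv_groth_cong] Iso_mult_biproduct[OF S]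
      unfolding groth_class_def by metis
  qed
  ultimately show ?thesis
    unfolding groth_monoid_def by (simp, blast)
qed

text \<open>The direct sum of \<open>A\<close> and \<open>B\<close> lies in the same extension set
  as \<open>U\<close>, so the congruence identifies the two.\<close>

lemma groth_mult_Ext1:
  assumes A: "A \<in> Obj C" and B: "B \<in> Obj C" and U: "U \<in> Ext1 C A B"
  shows "groth_class C A \<otimes>\<^bsub>groth_monoid C\<^esub> groth_class C B = groth_cong C `` {U}"
proof -
  obtain S i1 i2 p1 p2 where S: "is_biproduct C A B S i1 i2 p1 p2"
    using ex_biproduct[OF A B] by blast
  have "(iso_class C S, U) \<in> groth_cong C"
    using groth_congI[OF A B biproduct_in_Ext1[OF S] U] .
  then have "groth_class C S = groth_cong C `` {U}"
    unfolding groth_class_def by (rule equiv_class_eq[OF equiv_groth_cong])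
  then show ?thesis
    using groth_mult_biproduct[OF S] by simp
qed

end

section \<open>Finitely many extension pairs versus finitely many decompositions\<close>

theorem theorem1p4:
  fixes C :: "('o, 'm) exact_cat"
  assumes "profinitary C"
  shows "cofinitary C \<longleftrightarrow> locally_finite (groth_monoid C)"
proof
  interpret profinitary C
    by (rule assms)
  let ?G = "groth_monoid C"
  let ?pairs = "\<lambda>U. {(iso_class C A, iso_class C B) | A B. A \<in> Obj C \<and> B \<in> Obj C \<and> U \<in> Ext1 C A B}"
  let ?splits = "\<lambda>\<gamma>. {(\<alpha>, \<beta>). \<alpha> \<in> carrier ?G \<and> \<beta> \<in> carrier ?G \<and> \<alpha> \<otimes>\<^bsub>?G\<^esub> \<beta> = \<gamma>}"
  {
    assume "cofinitary C"
    then interpret cofinitary C .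
    show "locally_finite ?G"
      unfolding locally_finite_def
    proof
      fix \<gamma> assume \<gamma>: "\<gamma> \<in> carrier ?G"
      let ?cl = "\<lambda>U. groth_cong C `` {U}"
      \<comment> \<open>The map \<open>?cl\<close> sends an isomorphism class to its class in the
        Grothendieck monoid. A decomposition of \<gamma> is the image of a pair of isomorphism
        classes whose direct sum lies in the fiber over \<gamma>.\<close>
      have "?splits \<gamma> \<subseteq> map_prod ?cl ?cl ` (\<Union>U \<in> Iso_fiber C \<gamma>. ?pairs U)"
      proof clarify
        fix \<alpha> \<beta> assume \<alpha>: "\<alpha> \<in> carrier ?G" and \<beta>: "\<beta> \<in> carrier ?G" and eq: "\<gamma> = \<alpha> \<otimes>\<^bsub>?G\<^esub> \<beta>"
        obtain A where A: "A \<in> Obj C" "\<alpha> = groth_class C A"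
          using groth_monoid_cases[OF \<alpha>] .
        obtain B where B: "B \<in> Obj C" "\<beta> = groth_class C B"
          using groth_monoid_cases[OF \<beta>] .
        obtain S i1 i2 p1 p2 where S: "is_biproduct C A B S i1 i2 p1 p2"
          using ex_biproduct[OF A(1) B(1)] by blast
        then have "S \<in> Obj C"
          unfolding is_biproduct_def by blast
        then have "iso_class C S \<in> Iso_fiber C (\<alpha> \<otimes>\<^bsub>?G\<^esub> \<beta>)"
          using groth_mult_biproduct[OF S] A B unfolding Iso_fiber_def by auto
        moreover have "(iso_class C A, iso_class C B) \<in> ?pairs (iso_class C S)"
          using biproduct_in_Ext1[OF S] A B by blast
        ultimately have "(iso_class C A, iso_class C B)
            \<in> (\<Union>U \<in> Iso_fiber C (\<alpha> \<otimes>\<^bsub>?G\<^esub> \<beta>). ?pairs U)"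
          by blast
        then show "(\<alpha>, \<beta>) \<in> map_prod ?cl ?cl ` (\<Union>U \<in> Iso_fiber C (\<alpha> \<otimes>\<^bsub>?G\<^esub> \<beta>). ?pairs U)"
          using A(2) B(2) unfolding groth_class_def by (metis (no_types, lifting) imageI map_prod_simp)
      qed
      moreover have "finite (?pairs U)" if "U \<in> Iso_fiber C \<gamma>" for U
        using that by (intro finite_pairs) (auto simp: Iso_fiber_def Iso_def)
      ultimately show "finite (?splits \<gamma>)"
        using finite_fiber[OF \<gamma>] by (meson finite_UN_I finite_imageI finite_subset)
    qed
  next
    assume lf: "locally_finite ?G"
    \<comment> \<open>Finiteness of the hom sets is already given by \<open>profinitary\<close>;
      what remains is to bound the pairs.\<close>
    show "cofinitary C"
    proof unfold_locales
      fix U assume "U \<in> carrier (Iso C)"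
      let ?\<gamma> = "groth_cong C `` {U}"
      have "?\<gamma> \<in> carrier ?G"
        using \<open>U \<in> carrier (Iso C)\<close> unfolding groth_monoid_def by (simp add: quotientI)
      then have fin: "finite (?splits ?\<gamma>)"
        using lf unfolding locally_finite_def by blast
      \<comment> \<open>Sort the pairs by their images in the Grothendieck monoid: local finiteness
        bounds the indices, and each index contributes a product of two finite fibers.\<close>
      have "?pairs U \<subseteq> (\<Union>(\<alpha>, \<beta>) \<in> ?splits ?\<gamma>. Iso_fiber C \<alpha> \<times> Iso_fiber C \<beta>)"
      proof clarify
        fix A B assume AB: "A \<in> Obj C" "B \<in> Obj C" "U \<in> Ext1 C A B"
        have "(groth_class C A, groth_class C B) \<in> ?splits ?\<gamma>"
          using groth_mult_Ext1[OF AB] groth_class_carrier AB(1,2) by blast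
        moreover have "iso_class C A \<in> Iso_fiber C (groth_class C A)"
            "iso_class C B \<in> Iso_fiber C (groth_class C B)"
          using AB unfolding Iso_fiber_def by blast+
        ultimately show "(iso_class C A, iso_class C B)
            \<in> (\<Union>(\<alpha>, \<beta>) \<in> ?splits ?\<gamma>. Iso_fiber C \<alpha> \<times> Iso_fiber C \<beta>)"
          by blast
      qed
      moreover have "finite (\<Union>(\<alpha>, \<beta>) \<in> ?splits ?\<gamma>. Iso_fiber C \<alpha> \<times> Iso_fiber C \<beta>)"
        using fin finite_fiber by (intro finite_UN_I) auto
      ultimately show "finite (?pairs U)"
        by (rule finite_subset)
    qed
  }
qed

end
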